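(* Let $n$ be a positive integer. Let $r\geq 0$ and $s\geq 1$ be integers such that $r\not\equiv s\pmod 2$. Then, for every integer $j$ with $0\leq j\leq s$, the expression $${2n\brack n}^{-1}\sum_{k=1}^{n}(1+q^k)[k]^{r}B_{n,k}(q)^{s}\,q^{jk^2-(r+s+1)k/2}$$ is a Laurent polynomial in $q$ with integer coefficients.
   Context: Here $q$ is an indeterminate. For a non-negative integer $n$, the $q$-integer is $[n]=\frac{1-q^n}{1-q}=1+q+\cdots+q^{n-1}$. The $q$-shifted factorials are $(a;q)_0=1$ and $(a;q)_n=(1-a)(1-aq)\cdots(1-aq^{n-1})$ for $n\geq 1$. The $q$-binomial coefficients are ${n\brack k}=\frac{(q;q)_n}{(q;q)_k(q;q)_{n-k}}$ if $0\leq k\leq n$, and ${n\brack k}=0$ otherwise. The $q$-Catalan triangle has entries $$B_{n,k}(q)=\frac{[k]}{[n]}{2n\brack n-k},\qquad 1\leq k\leq n.$$ The expression is a priori an element of the field $\mathbb{Q}(q)$; a Laurent polynomial with integer coefficients is an element of $\mathbb{Z}[q,q^{-1}]$. *)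

theory Defs
  imports "HOL-Computational_Algebra.Computational_Algebra"
begin

type_synonym ratfun = "rat poly fract"

text \<open>The indeterminate as an element of the field of rational functions over the rationals.\<close>

definition qvar :: ratfun where
  "qvar = to_fract [:0, 1:]"

definition qint :: "nat \<Rightarrow> ratfun" where
  "qint n = (1 - qvar ^ n) / (1 - qvar)"

definition qfact :: "ratfun \<Rightarrow> nat \<Rightarrow> ratfun" where
  "qfact a n = (\<Prod>i<n. 1 - a * qvar ^ i)"

definition qbinom :: "nat \<Rightarrow> nat \<Rightarrow> ratfun" where
  "qbinom n k =
     (if k \<le> n then qfact qvar n / (qfact qvar k * qfact qvar (n - k)) else 0)"

text \<open>The entries of the triangle are meant for \<open>1 \<le> k \<le> n\<close> only; outside this range
  the subtraction on the naturals and the division by \<open>qint 0 = 0\<close> yield junk values.\<close>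

definition qCatalan :: "nat \<Rightarrow> nat \<Rightarrow> ratfun" where
  "qCatalan n k = qint k / qint n * qbinom (2 * n) (n - k)"

definition int_laurent_polys :: "ratfun set" where
  "int_laurent_polys =
     {\<Sum>i\<in>I. of_int (c i) * qvar powi i | (I :: int set) (c :: int \<Rightarrow> int). finite I}"

end

theory Submission
  imports Defs "HOL-Computational_Algebra.Field_as_Ring"
begin

text \<open>
  Write \<open>q\<close> for \<open>qvar\<close>, \<open>(n)\<close> for \<open>qfact q n\<close>, \<open>X\<close> for the expression of the theorem and
  \<open>r + s = 2 m + 1\<close>.  The factor \<open>[n]\<close> in the denominator of the entries \<open>[k] / [n] * qbinom (2n) (n-k)\<close>
  and the central coefficient \<open>qbinom (2n) n\<close> are handled separately, because over the rationals
  these two polynomials have no common factor: a prime polynomial \<open>p\<close> that divides \<open>1 - q^n\<close> divides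
  \<open>1 - q^(n+i)\<close> exactly when it divides \<open>1 - q^i\<close>, and it does so only once, as \<open>1 - q^i\<close> is
  squarefree; hence \<open>p\<close> cancels from \<open>(2n) / (n)^2\<close> (\<open>coprime_central_qbinom\<close>).  This is special to the
  \<open>q\<close>-analogue; at \<open>q = 1\<close> the numbers \<open>n\<close> and \<open>2n choose n\<close> may well share factors.  It
  therefore suffices that \<open>qbinom (2n) n * X\<close> and \<open>(1 - q^n)^s * X\<close> are integral
  (\<open>laurent_of_coprime_multiples\<close>).  The first is clear, since the entries of the triangle are
  themselves integral (\<open>laurent_qCatalan\<close>).

  For the second, put \<open>c(l,k) = (l)^2 / ((l-k) (l+k))\<close>, so that \<open>qbinom (2n) (n-k)\<close> is
  \<open>qbinom (2n) n * c(n,k)\<close>.  Up to powers of \<open>1 - q\<close> it is the sum over \<open>k\<close> of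
  \<open>w(k) * qbinom (2n) (n-k)^(s-1) * c(n,k)\<close>, where
  \<open>w(k) = (1 + q^k) [k]^(2m+1) q^(j k^2 - (m+1) k)\<close>.  The \<open>q\<close>-Vandermonde identity expands each product
  \<open>qbinom n l * qbinom (2n) (n-k) * c(l,k)\<close> into a sum of \<open>qbinom n t * c(t,k)\<close> for \<open>k \<le> t \<le> l\<close> with
  integral coefficients that do not depend on \<open>k\<close> (\<open>linearization\<close>), and in its second form it also absorbs
  one factor \<open>q^(k^2)\<close> (\<open>linearization_gaussian\<close>).  Expanding \<open>s - 1\<close> times removes all the
  binomial coefficients that depend on \<open>k\<close>; since \<open>j \<le> s\<close>, the exponent \<open>j\<close> can be brought down to at most 1
  on the way (\<open>laurent_power_moment\<close>).  What remains is the sum of \<open>w(k) c(l,k)\<close> with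
  \<open>j \<le> 1\<close>, which telescopes to \<open>[l]\<close> (times a power of \<open>q\<close>) for \<open>m = 0\<close> and satisfies a recursion
  with integral coefficients in \<open>m\<close> (\<open>laurent_moment\<close>).
\<close>

section \<open>Laurent polynomials with integer coefficients\<close>

definition int_coeffs :: "rat poly set" where
  "int_coeffs = {p. \<forall>i. coeff p i \<in> \<int>}"

lemma int_coeffs_add: "p \<in> int_coeffs \<Longrightarrow> p' \<in> int_coeffs \<Longrightarrow> p + p' \<in> int_coeffs"
  by (auto simp: int_coeffs_def)

lemma int_coeffs_diff: "p \<in> int_coeffs \<Longrightarrow> p' \<in> int_coeffs \<Longrightarrow> p - p' \<in> int_coeffs"
  by (auto simp: int_coeffs_def)

lemma int_coeffs_mult: "p \<in> int_coeffs \<Longrightarrow> p' \<in> int_coeffs \<Longrightarrow> p * p' \<in> int_coeffs"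
  by (auto simp: int_coeffs_def coeff_mult intro!: Ints_sum)

lemma int_coeffs_monom: "a \<in> \<int> \<Longrightarrow> monom a i \<in> int_coeffs"
  by (auto simp: int_coeffs_def)

lemma qvar_power: "qvar ^ i = to_fract (monom 1 i)"
proof (induction i)
  case (Suc i)
  have "monom 1 (Suc i) = [:0, 1:] * (monom 1 i :: rat poly)"
    by (simp add: monom_Suc)
  then show ?case using Suc by (simp only: qvar_def power_Suc to_fract_mult)
qed simp

lemma qvar_nonzero [simp]: "qvar \<noteq> 0"
  by (simp add: qvar_def)

lemma of_int_eq_to_fract: "of_int z = to_fract (monom (of_int z :: rat) 0)"
proof -
  have "of_nat k = to_fract (of_nat k :: rat poly)" for k
    by (induction k) simp_all
  then have "of_int z = to_fract (of_int z :: rat poly)"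
    by (cases z) simp_all
  then show ?thesis by (simp only: of_int_monom)
qed

text \<open>
  Polynomials with integral rational coefficients, rather than integer polynomials, serve as numerators:
  the coprimality argument at the end takes place over the field of rationals, and its result then has to
  be recognized as integral.
\<close>

lemma int_laurent_polys_iff:
  "z \<in> int_laurent_polys \<longleftrightarrow> (\<exists>N. \<exists>p\<in>int_coeffs. z * qvar ^ N = to_fract p)"
proof
  assume "z \<in> int_laurent_polys"
  then obtain I :: "int set" and c :: "int \<Rightarrow> int"
    where I: "finite I" and z: "z = (\<Sum>i\<in>I. of_int (c i) * qvar powi i)"
    by (auto simp: int_laurent_polys_def)
  \<comment> \<open>The inserted 0 only keeps the maximum defined when \<open>I\<close> is empty.\<close>
  define N where "N = nat (Max (insert 0 ((\<lambda>i. - i) ` I)))"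
  have N: "0 \<le> i + int N" if "i \<in> I" for i
  proof -
    have "- i \<le> Max (insert 0 ((\<lambda>i. - i) ` I))"
      using that I by (intro Max_ge) auto
    then show ?thesis unfolding N_def by linarith
  qed
  have "z * qvar ^ N = (\<Sum>i\<in>I. of_int (c i) * qvar powi (i + int N))"
    by (simp add: z sum_distrib_right power_int_add mult.assoc)
  also have "\<dots> = (\<Sum>i\<in>I. to_fract (monom (of_int (c i)) (nat (i + int N))))"
  proof (intro sum.cong refl)
    fix i assume "i \<in> I"
    then have "qvar powi (i + int N) = qvar ^ nat (i + int N)"
      using N[of i] by (simp add: power_int_def)
    then show "of_int (c i) * qvar powi (i + int N)
                 = to_fract (monom (of_int (c i)) (nat (i + int N)))"
      by (simp add: qvar_power of_int_eq_to_fract mult_monom flip: to_fract_mult)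
  qed
  finally have "z * qvar ^ N
      = to_fract (\<Sum>i\<in>I. monom (of_int (c i)) (nat (i + int N)))"
    by (simp add: to_fract_sum)
  moreover have "(\<Sum>i\<in>I. monom (of_int (c i)) (nat (i + int N))) \<in> int_coeffs"
    by (auto simp: int_coeffs_def coeff_sum intro!: Ints_sum)
  ultimately show "\<exists>N. \<exists>p\<in>int_coeffs. z * qvar ^ N = to_fract p" by blast
next
  assume "\<exists>N. \<exists>p\<in>int_coeffs. z * qvar ^ N = to_fract p"
  then obtain N p where p: "p \<in> int_coeffs" and z: "z * qvar ^ N = to_fract p" by blast
  define c where "c i = \<lfloor>coeff p (nat (i + int N))\<rfloor>" for i
  define I where "I = (\<lambda>i. int i - int N) ` {..degree p}"
  have c: "of_int (c (int i - int N)) = coeff p i" for i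
    using p unfolding c_def int_coeffs_def by (auto simp: of_int_floor)
  have "to_fract p = (\<Sum>i\<le>degree p. to_fract (monom (coeff p i) i))"
    by (metis (no_types) poly_as_sum_of_monoms to_fract_sum)
  also have "\<dots> = (\<Sum>i\<le>degree p. of_int (c (int i - int N)) * qvar ^ i)"
    by (intro sum.cong refl)
       (simp add: c of_int_eq_to_fract qvar_power mult_monom flip: to_fract_mult)
  finally have "z = (\<Sum>i\<le>degree p. of_int (c (int i - int N)) * qvar ^ i) / qvar ^ N"
    using z by (simp add: field_simps)
  also have "\<dots> = (\<Sum>i\<le>degree p. of_int (c (int i - int N)) * qvar powi (int i - int N))"
    by (simp add: sum_divide_distrib power_int_diff)
  also have "\<dots> = (\<Sum>i\<in>I. of_int (c i) * qvar powi i)"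
    unfolding I_def by (subst sum.reindex) (auto simp: inj_on_def)
  finally show "z \<in> int_laurent_polys"
    unfolding int_laurent_polys_def I_def by blast
qed

lemma int_laurent_polys_common_denominator:
  assumes "x \<in> int_laurent_polys" "y \<in> int_laurent_polys"
  obtains N p p' where "p \<in> int_coeffs" "p' \<in> int_coeffs"
    "x * qvar ^ N = to_fract p" "y * qvar ^ N = to_fract p'"
proof -
  obtain M p M' p' where p: "p \<in> int_coeffs" "x * qvar ^ M = to_fract p"
    and p': "p' \<in> int_coeffs" "y * qvar ^ M' = to_fract p'"
    using assms unfolding int_laurent_polys_iff by blast
  show thesis
  proof (rule that)
    show "p * monom 1 M' \<in> int_coeffs" "p' * monom 1 M \<in> int_coeffs"
      using p p' by (auto intro!: int_coeffs_mult int_coeffs_monom)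
    show "x * qvar ^ (M + M') = to_fract (p * monom 1 M')"
      by (simp add: p(2)[symmetric] power_add qvar_power)
    show "y * qvar ^ (M + M') = to_fract (p' * monom 1 M)"
      by (simp add: p'(2)[symmetric] power_add qvar_power)
  qed
qed

named_theorems laurent_intros

lemma laurent_add [laurent_intros]:
  assumes "x \<in> int_laurent_polys" "y \<in> int_laurent_polys"
  shows "x + y \<in> int_laurent_polys"
proof -
  obtain N p p' where p: "p \<in> int_coeffs" "p' \<in> int_coeffs"
    and x: "x * qvar ^ N = to_fract p" and y: "y * qvar ^ N = to_fract p'"
    using assms by (rule int_laurent_polys_common_denominator)
  have "(x + y) * qvar ^ N = to_fract (p + p')"
    by (simp only: distrib_right x y to_fract_add)
  with int_coeffs_add[OF p] show ?thesis unfolding int_laurent_polys_iff by blast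
qed

lemma laurent_diff [laurent_intros]:
  assumes "x \<in> int_laurent_polys" "y \<in> int_laurent_polys"
  shows "x - y \<in> int_laurent_polys"
proof -
  obtain N p p' where p: "p \<in> int_coeffs" "p' \<in> int_coeffs"
    and x: "x * qvar ^ N = to_fract p" and y: "y * qvar ^ N = to_fract p'"
    using assms by (rule int_laurent_polys_common_denominator)
  have "(x - y) * qvar ^ N = to_fract (p - p')"
    by (simp only: left_diff_distrib x y to_fract_diff)
  with int_coeffs_diff[OF p] show ?thesis unfolding int_laurent_polys_iff by blast
qed

lemma laurent_mult [laurent_intros]:
  assumes "x \<in> int_laurent_polys" "y \<in> int_laurent_polys"
  shows "x * y \<in> int_laurent_polys"
proof -
  obtain N p p' where p: "p \<in> int_coeffs" "p' \<in> int_coeffs"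
    and x: "x * qvar ^ N = to_fract p" and y: "y * qvar ^ N = to_fract p'"
    using assms by (rule int_laurent_polys_common_denominator)
  have "(x * y) * qvar ^ (N + N) = to_fract (p * p')"
    unfolding to_fract_mult x[symmetric] y[symmetric] by (simp only: power_add mult_ac)
  with int_coeffs_mult[OF p] show ?thesis unfolding int_laurent_polys_iff by blast
qed

lemma laurent_of_poly: "p \<in> int_coeffs \<Longrightarrow> to_fract p \<in> int_laurent_polys"
  unfolding int_laurent_polys_iff by (intro exI[of _ 0]) auto

lemma laurent_of_int [laurent_intros]: "of_int z \<in> int_laurent_polys"
  by (simp add: of_int_eq_to_fract laurent_of_poly int_coeffs_monom)

lemma laurent_0_1 [laurent_intros]: "0 \<in> int_laurent_polys" "1 \<in> int_laurent_polys"
  using laurent_of_int[of 0] laurent_of_int[of 1] by simp_all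

lemma laurent_qvar_power [laurent_intros]: "qvar ^ i \<in> int_laurent_polys"
  by (simp add: qvar_power laurent_of_poly int_coeffs_monom)

lemma laurent_qvar_powi [laurent_intros]: "qvar powi i \<in> int_laurent_polys"
proof (cases "i \<ge> 0")
  case True
  then show ?thesis by (simp add: power_int_def laurent_intros)
next
  case False
  then have "qvar powi i * qvar ^ nat (- i) = to_fract (monom 1 0)"
    by (simp add: power_int_def field_simps)
  moreover have "monom 1 0 \<in> int_coeffs"
    by (rule int_coeffs_monom) simp
  ultimately show ?thesis unfolding int_laurent_polys_iff by blast
qed

lemma laurent_sum [laurent_intros]:
  "(\<And>x. x \<in> A \<Longrightarrow> f x \<in> int_laurent_polys) \<Longrightarrow> sum f A \<in> int_laurent_polys"
  by (induction A rule: infinite_finite_induct) (auto intro: laurent_intros)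

lemma laurent_power [laurent_intros]: "x \<in> int_laurent_polys \<Longrightarrow> x ^ i \<in> int_laurent_polys"
  by (induction i) (auto intro: laurent_intros)

section \<open>Gaussian binomial coefficients\<close>

lemma qvar_power_neq_1: "i > 0 \<Longrightarrow> qvar ^ i \<noteq> 1"
proof
  assume i: "i > 0" and "qvar ^ i = 1"
  then have "to_fract (monom 1 i) = to_fract (1 :: rat poly)"
    by (simp add: qvar_power)
  then have "monom 1 i = (1 :: rat poly)" by (simp only: to_fract_eq_iff)
  then have "degree (monom 1 i :: rat poly) = 0" by simp
  with i show False by (simp add: degree_monom_eq)
qed

lemma qvar_neq_1 [simp]: "qvar \<noteq> 1"
  using qvar_power_neq_1[of 1] by simp

lemma qvar_powi_add: "qvar powi (a + b) = qvar powi a * qvar powi b"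
  by (simp add: power_int_add)

lemma one_minus_qvar_double: "1 - qvar ^ (2 * k) = (1 - qvar ^ k) * (1 + qvar ^ k)"
  unfolding power_even_eq power2_eq_square by (simp add: algebra_simps)

lemma qfact_0 [simp]: "qfact a 0 = 1"
  by (simp add: qfact_def)

lemma qfact_Suc: "qfact qvar (Suc n) = qfact qvar n * (1 - qvar ^ Suc n)"
  by (simp add: qfact_def)

lemma qfact_rec: "n > 0 \<Longrightarrow> qfact qvar n = qfact qvar (n - 1) * (1 - qvar ^ n)"
  using qfact_Suc[of "n - 1"] by simp

lemma qfact_nonzero [simp]: "qfact qvar n \<noteq> 0"
  by (induction n) (use qvar_power_neq_1 in \<open>auto simp: qfact_Suc simp del: power_Suc\<close>)

lemma qbinom_0 [simp]: "qbinom n 0 = 1"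
  by (simp add: qbinom_def)

lemma qbinom_0_Suc [simp]: "qbinom 0 (Suc k) = 0"
  by (simp add: qbinom_def)

lemma qbinom_Suc_Suc: "qbinom (Suc n) (Suc k) = qbinom n k + qvar ^ Suc k * qbinom n (Suc k)"
proof -
  consider "k < n" | "k = n" | "k > n" by linarith
  then show ?thesis
  proof cases
    case 1
    define d where "d = n - k - 1"
    have n: "n = k + Suc d" using 1 by (simp add: d_def)
    have "1 - qvar ^ (Suc k + Suc d)
          = (1 - qvar ^ Suc k) + qvar ^ Suc k * (1 - qvar ^ Suc d)"
      by (simp add: algebra_simps power_add)
    moreover have "1 - qvar ^ Suc k \<noteq> 0" "1 - qvar ^ Suc d \<noteq> 0"
      using qvar_power_neq_1[of "Suc k"] qvar_power_neq_1[of "Suc d"] by auto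
    ultimately show ?thesis
      unfolding n by (simp add: qbinom_def qfact_Suc divide_simps del: power_Suc) (simp add: algebra_simps)
  qed (auto simp: qbinom_def)
qed

text \<open>
  The denominators cancel by Pascal's rule, without negative powers of the indeterminate.
\<close>

lemma qbinom_polynomial: "\<exists>p\<in>int_coeffs. qbinom n k = to_fract p"
proof (induction n arbitrary: k)
  case 0
  show ?case
  proof (cases k)
    case 0
    then show ?thesis using int_coeffs_monom[of 1 0] by (intro bexI[of _ 1]) auto
  next
    case (Suc k')
    then show ?thesis by (intro bexI[of _ 0]) (auto simp: int_coeffs_def)
  qed
next
  case (Suc n)
  show ?case
  proof (cases k)
    case 0
    then show ?thesis using int_coeffs_monom[of 1 0] by (intro bexI[of _ 1]) auto
  next
    case (Suc k')
    obtain p p' where "p \<in> int_coeffs" "p' \<in> int_coeffs"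
      "qbinom n k' = to_fract p" "qbinom n (Suc k') = to_fract p'"
      using Suc.IH by blast
    then show ?thesis unfolding Suc qbinom_Suc_Suc qvar_power
      by (intro bexI[of _ "p + monom 1 (Suc k') * p'"])
         (auto intro!: int_coeffs_add int_coeffs_mult int_coeffs_monom)
  qed
qed

lemma laurent_qbinom [laurent_intros]: "qbinom n k \<in> int_laurent_polys"
  using qbinom_polynomial[of n k] laurent_of_poly by auto

text \<open>
  Induction on \<open>a\<close> by Pascal's rule.  The truncated difference \<open>a - i\<close> is harmless, since
  \<open>qbinom a i\<close> vanishes where it truncates.
\<close>

lemma qbinom_vandermonde:
  "qbinom (a + b) c = (\<Sum>i\<le>c. qvar ^ ((a - i) * (c - i)) * qbinom a i * qbinom b (c - i))"
proof (induction a arbitrary: c)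
  case 0
  have "(\<Sum>i\<le>c. qvar ^ ((0 - i) * (c - i)) * qbinom 0 i * qbinom b (c - i))
      = (\<Sum>i\<in>{0}. qvar ^ ((0 - i) * (c - i)) * qbinom 0 i * qbinom b (c - i))"
    by (intro sum.mono_neutral_right) (auto simp: qbinom_def)
  then show ?case by simp
next
  case (Suc a)
  show ?case
  proof (cases c)
    case 0
    then show ?thesis by simp
  next
    case (Suc d)
    let ?f = "\<lambda>a c i. qvar ^ ((a - i) * (c - i)) * qbinom a i * qbinom b (c - i)"
    have shift: "qvar ^ ((Suc a - Suc i) * (Suc d - Suc i)) * (qvar ^ Suc i * qbinom a (Suc i))
          * qbinom b (Suc d - Suc i) = qvar ^ Suc d * ?f a (Suc d) (Suc i)" if "i \<le> d" for i
    proof (cases "Suc i \<le> a")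
      case True
      define u v where "u = a - Suc i" and "v = d - i"
      have "a = u + Suc i" "d = v + i" using True that by (auto simp: u_def v_def)
      then show ?thesis by (simp add: power_add algebra_simps)
    qed (simp add: qbinom_def)
    have "(\<Sum>i\<le>Suc d. ?f (Suc a) (Suc d) i)
        = ?f (Suc a) (Suc d) 0 + (\<Sum>i\<le>d. ?f (Suc a) (Suc d) (Suc i))"
      by (rule sum.atMost_Suc_shift)
    also have "(\<Sum>i\<le>d. ?f (Suc a) (Suc d) (Suc i))
        = (\<Sum>i\<le>d. ?f a d i) + (\<Sum>i\<le>d. qvar ^ Suc d * ?f a (Suc d) (Suc i))"
      unfolding sum.distrib[symmetric]
    proof (intro sum.cong refl)
      fix i assume "i \<in> {..d}"
      then have "i \<le> d" by simp
      from shift[OF this]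
      show "?f (Suc a) (Suc d) (Suc i) = ?f a d i + qvar ^ Suc d * ?f a (Suc d) (Suc i)"
        unfolding qbinom_Suc_Suc[of a i] by (simp only: distrib_left distrib_right diff_Suc_Suc)
    qed
    also have "?f (Suc a) (Suc d) 0 = qvar ^ Suc d * ?f a (Suc d) 0"
      by (simp add: power_add)
    also have "qvar ^ Suc d * ?f a (Suc d) 0
          + ((\<Sum>i\<le>d. ?f a d i) + (\<Sum>i\<le>d. qvar ^ Suc d * ?f a (Suc d) (Suc i)))
        = (\<Sum>i\<le>d. ?f a d i) + qvar ^ Suc d * (\<Sum>i\<le>Suc d. ?f a (Suc d) i)"
      unfolding sum.atMost_Suc_shift by (simp only: distrib_left sum_distrib_left add_ac)
    also have "\<dots> = qbinom (a + b) d + qvar ^ Suc d * qbinom (a + b) (Suc d)"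
      by (simp only: Suc.IH)
    also have "\<dots> = qbinom (Suc a + b) (Suc d)"
      by (simp only: qbinom_Suc_Suc add_Suc)
    finally show ?thesis unfolding Suc ..
  qed
qed

section \<open>Linearizing products\<close>

text \<open>
  For \<open>k \<le> l\<close> this is the quotient of \<open>qbinom (2 * l) (l - k)\<close> by the central coefficient
  \<open>qbinom (2 * l) l\<close>; all uses are in this range.
\<close>

definition central_ratio :: "nat \<Rightarrow> nat \<Rightarrow> ratfun" where
  "central_ratio l k = qfact qvar l ^ 2 / (qfact qvar (l - k) * qfact qvar (l + k))"

lemma qbinom_eq:
  "k + m = n \<Longrightarrow> qbinom n k = qfact qvar n / (qfact qvar k * qfact qvar m)"
  by (auto simp: qbinom_def)

text \<open>
  All summands of the Vandermonde convolution have the factor \<open>(n - k) (l + k)\<close> in common.  Exchanging it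
  for factors without \<open>k\<close> makes the coefficients of \<open>central_ratio t k\<close> independent of \<open>k\<close> (apart from
  the power of the indeterminate \<open>e t\<close>), so that a sum over \<open>k\<close> can later be carried out first.
\<close>

lemma linearization_of_vandermonde:
  assumes "k \<le> l" "l \<le> n"
    and vandermonde: "qbinom (n + l) (l - k)
      = (\<Sum>t=k..l. e t * (qbinom (n - k) (t - k) * qbinom (l + k) (l - t)))"
  shows "qbinom n l * qbinom (2 * n) (n - k) * central_ratio l k
      = qbinom (2 * n) (n - l) * (\<Sum>t=k..l. e t * (qbinom l t * qbinom n t * central_ratio t k))"
proof -
  define K where "K = qfact qvar (2 * n) * qfact qvar l * qfact qvar n /
    (qfact qvar (n - l) * qfact qvar (n + l) * qfact qvar (n - k) * qfact qvar (l + k))"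
  have "qbinom (2 * n) (n - l) * (e t * (qbinom l t * qbinom n t * central_ratio t k))
      = K * (e t * (qbinom (n - k) (t - k) * qbinom (l + k) (l - t)))"
    if "t \<in> {k..l}" for t
  proof -
    have "qbinom (2 * n) (n - l) = qfact qvar (2 * n) / (qfact qvar (n - l) * qfact qvar (n + l))"
      "qbinom (n - k) (t - k) = qfact qvar (n - k) / (qfact qvar (t - k) * qfact qvar (n - t))"
      "qbinom (l + k) (l - t) = qfact qvar (l + k) / (qfact qvar (l - t) * qfact qvar (t + k))"
      "qbinom l t = qfact qvar l / (qfact qvar t * qfact qvar (l - t))"
      "qbinom n t = qfact qvar n / (qfact qvar t * qfact qvar (n - t))"
      using that assms(1,2) by (auto intro!: qbinom_eq)
    then show ?thesis
      by (simp add: central_ratio_def K_def power2_eq_square mult_ac)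
  qed
  then have "qbinom (2 * n) (n - l) * (\<Sum>t=k..l. e t * (qbinom l t * qbinom n t * central_ratio t k))
      = K * qbinom (n + l) (l - k)"
    unfolding vandermonde sum_distrib_left by (intro sum.cong refl)
  moreover have "qbinom n l * qbinom (2 * n) (n - k) * central_ratio l k = K * qbinom (n + l) (l - k)"
  proof -
    have "qbinom (2 * n) (n - k) = qfact qvar (2 * n) / (qfact qvar (n - k) * qfact qvar (n + k))"
      "qbinom (n + l) (l - k) = qfact qvar (n + l) / (qfact qvar (l - k) * qfact qvar (n + k))"
      "qbinom n l = qfact qvar n / (qfact qvar l * qfact qvar (n - l))"
      using assms(1,2) by (auto intro!: qbinom_eq)
    then show ?thesis
      by (simp add: central_ratio_def K_def power2_eq_square mult_ac)
  qed
  ultimately show ?thesis by simp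
qed

text \<open>
  Choosing \<open>t - k\<close> elements among \<open>n - k\<close> and \<open>l - t\<close> among \<open>l + k\<close>: in this order the power of the
  indeterminate in the Vandermonde convolution is free of \<open>k\<close>.
\<close>

lemma linearization:
  assumes "k \<le> l" "l \<le> n"
  shows "qbinom n l * qbinom (2 * n) (n - k) * central_ratio l k
      = qbinom (2 * n) (n - l) *
          (\<Sum>t=k..l. qvar ^ ((n - t) * (l - t)) * (qbinom l t * qbinom n t * central_ratio t k))"
proof (rule linearization_of_vandermonde[OF assms])
  have "n + l = (n - k) + (l + k)" using assms by simp
  then have "qbinom (n + l) (l - k) = (\<Sum>i\<le>l - k. qvar ^ ((n - k - i) * (l - k - i))
      * qbinom (n - k) i * qbinom (l + k) (l - k - i))"
    by (metis qbinom_vandermonde)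
  also have "\<dots> = (\<Sum>t=k..l. qvar ^ ((n - t) * (l - t)) *
      (qbinom (n - k) (t - k) * qbinom (l + k) (l - t)))"
    by (rule sum.reindex_bij_witness[of _ "\<lambda>t. t - k" "\<lambda>i. i + k"])
       (use assms in \<open>auto simp: algebra_simps\<close>)
  finally show "qbinom (n + l) (l - k) = \<dots>" .
qed

text \<open>
  Exchanging the two factors of the Vandermonde convolution turns the exponent into
  \<open>(t + k) (t - k) = t^2 - k^2\<close>, and multiplication by \<open>q^(k^2)\<close> removes its dependence on \<open>k\<close>.
\<close>

lemma linearization_gaussian:
  assumes "k \<le> l" "l \<le> n"
  shows "qvar ^ (k ^ 2) * (qbinom n l * qbinom (2 * n) (n - k) * central_ratio l k)
      = qbinom (2 * n) (n - l) *
          (\<Sum>t=k..l. qvar ^ (t ^ 2) * (qbinom l t * qbinom n t * central_ratio t k))"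
proof -
  have "n + l = (l + k) + (n - k)" using assms by simp
  then have "qbinom (n + l) (l - k) = (\<Sum>i\<le>l - k. qvar ^ ((l + k - i) * (l - k - i))
      * qbinom (l + k) i * qbinom (n - k) (l - k - i))"
    by (metis qbinom_vandermonde)
  also have "\<dots> = (\<Sum>t=k..l. qvar ^ ((t + k) * (t - k)) *
      (qbinom (n - k) (t - k) * qbinom (l + k) (l - t)))"
    by (rule sum.reindex_bij_witness[of _ "\<lambda>t. l - t" "\<lambda>i. l - i"])
       (use assms in \<open>auto simp: algebra_simps\<close>)
  finally have lin: "qbinom n l * qbinom (2 * n) (n - k) * central_ratio l k
      = qbinom (2 * n) (n - l) * (\<Sum>t=k..l. qvar ^ ((t + k) * (t - k))
          * (qbinom l t * qbinom n t * central_ratio t k))"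
    by (rule linearization_of_vandermonde[OF assms])
  have e: "qvar ^ (t ^ 2) = qvar ^ (k ^ 2) * qvar ^ ((t + k) * (t - k))" if "k \<le> t" for t
  proof -
    obtain d where "t = k + d" using le_Suc_ex[OF \<open>k \<le> t\<close>] by blast
    then show ?thesis
      unfolding power_add[symmetric] by (simp add: power2_eq_square algebra_simps)
  qed
  show ?thesis
    unfolding lin mult.left_commute[of "qvar ^ (k ^ 2)"]
    unfolding sum_distrib_left by (intro sum.cong refl) (simp add: e[symmetric] flip: mult.assoc)
qed

section \<open>Moments of the central ratios\<close>

text \<open>
  For \<open>j = 0\<close> this is \<open>([k]^2 q^(-k))^m\<close> times \<open>(q^(-k) - q^k) / (1 - q)\<close>; both factors change only by a
  power of \<open>q\<close> that is independent of \<open>k\<close> when \<open>q\<close> is replaced by its inverse, and the first is a polynomial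
  in \<open>q^k + q^(-k)\<close>.
\<close>

definition weight :: "nat \<Rightarrow> nat \<Rightarrow> nat \<Rightarrow> ratfun" where
  "weight m j k = (1 + qvar ^ k) * qint k ^ (2 * m + 1)
     * qvar powi (int j * int k ^ 2 - (int m + 1) * int k)"

lemma laurent_qint [laurent_intros]: "qint k \<in> int_laurent_polys"
proof -
  have "qint k = (\<Sum>i<k. qvar ^ i)"
    using sum_gp_strict[of qvar k] by (simp add: qint_def split: if_splits)
  then show ?thesis by (simp add: laurent_intros)
qed

lemma central_ratio_0 [simp]: "central_ratio l 0 = 1"
  by (simp add: central_ratio_def power2_eq_square)

lemma central_ratio_Suc:
  assumes "k < l"
  shows "(1 - qvar ^ (l + Suc k)) * central_ratio l (Suc k) = (1 - qvar ^ (l - k)) * central_ratio l k"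
proof -
  have "qfact qvar (l - k) = qfact qvar (l - Suc k) * (1 - qvar ^ (l - k))"
    using assms qfact_rec[of "l - k"] by simp
  moreover have "qfact qvar (l + Suc k) = qfact qvar (l + k) * (1 - qvar ^ (l + Suc k))"
    using qfact_Suc[of "l + k"] by simp
  moreover have "1 - qvar ^ (l - k) \<noteq> 0" "1 - qvar ^ (l + Suc k) \<noteq> 0"
    using assms qvar_power_neq_1[of "l - k"] qvar_power_neq_1[of "l + Suc k"] by auto
  ultimately show ?thesis
    by (simp add: central_ratio_def)
qed

lemma central_ratio_pred:
  assumes "k < l"
  shows "(1 - qvar ^ (l - k)) * (1 - qvar ^ (l + k)) * central_ratio l k
       = (1 - qvar ^ l) ^ 2 * central_ratio (l - 1) k"
proof -
  have "qfact qvar (l - k) = qfact qvar (l - 1 - k) * (1 - qvar ^ (l - k))"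
    using assms qfact_rec[of "l - k"] by (simp add: diff_right_commute)
  moreover have "qfact qvar (l + k) = qfact qvar (l - 1 + k) * (1 - qvar ^ (l + k))"
    using assms qfact_rec[of "l + k"] by simp
  moreover have "qfact qvar l = qfact qvar (l - 1) * (1 - qvar ^ l)"
    using assms qfact_rec[of l] by simp
  moreover have "1 - qvar ^ (l - k) \<noteq> 0" "1 - qvar ^ (l + k) \<noteq> 0"
    using assms qvar_power_neq_1[of "l - k"] qvar_power_neq_1[of "l + k"] by auto
  ultimately show ?thesis
    by (simp add: central_ratio_def power_mult_distrib)
qed

text \<open>
  With \<open>h(k) = (1 - q^(l+k)) c(l,k)\<close>, which is \<open>(1 - q^(l-k+1)) c(l,k-1)\<close> by \<open>central_ratio_Suc\<close>, the identity
  \<open>q^(l-k) - q^(l+k) = (1 - q^(l+k)) - (1 - q^(l-k))\<close> turns \<open>q^l\<close> times the summand into \<open>h(k) - h(k+1)\<close>.  For \<open>K = l\<close> the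
  last term vanishes.
\<close>

lemma telescope_plain:
  "K \<le> l \<Longrightarrow> qvar ^ l * (\<Sum>k=1..K. (1 - qvar ^ (2 * k)) * qvar powi (- int k) * central_ratio l k)
     = (1 - qvar ^ l) - (1 - qvar ^ (l - K)) * central_ratio l K"
proof (induction K)
  case (Suc K)
  define d where "d = l - Suc K"
  have l: "l = d + Suc K" using Suc.prems by (simp add: d_def)
  have "qvar ^ l * ((1 - qvar ^ (2 * Suc K)) * qvar powi (- int (Suc K)))
      = (1 - qvar ^ (l + Suc K)) - (1 - qvar ^ (l - Suc K))"
    unfolding l power_int_minus power_int_of_nat power_even_eq power_add[of _ _ "Suc K"]
    by (simp add: field_simps power2_eq_square del: power_Suc)
  then have "qvar ^ l * ((1 - qvar ^ (2 * Suc K)) * qvar powi (- int (Suc K)) * central_ratio l (Suc K))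
      = (1 - qvar ^ (l + Suc K)) * central_ratio l (Suc K)
        - (1 - qvar ^ (l - Suc K)) * central_ratio l (Suc K)"
    by (metis (no_types) left_diff_distrib mult.assoc)
  then show ?case
    using Suc central_ratio_Suc[of K l] by (simp add: distrib_left)
qed simp

text \<open>
  The telescope of \<open>telescope_plain\<close>, now with \<open>q^(k^2-k) h(k)\<close> in place of \<open>h(k)\<close>; it fits because
  \<open>(k+1)^2 - (k+1) = k^2 + k\<close>.
\<close>

lemma telescope_gaussian:
  "K \<le> l \<Longrightarrow> (\<Sum>k=1..K. (1 - qvar ^ (2 * k)) * qvar powi (int k ^ 2 - int k) * central_ratio l k)
     = (1 - qvar ^ l) - qvar ^ (K ^ 2 + K) * ((1 - qvar ^ (l - K)) * central_ratio l K)"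
proof (induction K)
  case (Suc K)
  have e: "int (Suc K) ^ 2 - int (Suc K) = int (K ^ 2 + K)"
    by (simp add: power2_eq_square algebra_simps)
  have "(1 - qvar ^ (2 * Suc K)) * qvar powi (int (Suc K) ^ 2 - int (Suc K))
      = qvar ^ (K ^ 2 + K) * (1 - qvar ^ (l + Suc K))
        - qvar ^ (Suc K ^ 2 + Suc K) * (1 - qvar ^ (l - Suc K))"
    unfolding e power_int_of_nat
  proof -
    have "(1 - a) * b = b * (1 - c) - e * (1 - f)" if "b * a = e" "b * c = e * f"
      for a b c e f :: ratfun
      using that by (simp add: algebra_simps)
    moreover have "qvar ^ (K ^ 2 + K) * qvar ^ (2 * Suc K) = qvar ^ (Suc K ^ 2 + Suc K)"
      "qvar ^ (K ^ 2 + K) * qvar ^ (l + Suc K) = qvar ^ (Suc K ^ 2 + Suc K) * qvar ^ (l - Suc K)"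
      unfolding power_add[symmetric] using Suc.prems
      by (intro arg_cong[where f = "\<lambda>i. qvar ^ i"]; simp add: power2_eq_square)+
    ultimately show "(1 - qvar ^ (2 * Suc K)) * qvar ^ (K ^ 2 + K)
      = qvar ^ (K ^ 2 + K) * (1 - qvar ^ (l + Suc K))
        - qvar ^ (Suc K ^ 2 + Suc K) * (1 - qvar ^ (l - Suc K))" by blast
  qed
  then have "(1 - qvar ^ (2 * Suc K)) * qvar powi (int (Suc K) ^ 2 - int (Suc K)) * central_ratio l (Suc K)
      = qvar ^ (K ^ 2 + K) * ((1 - qvar ^ (l + Suc K)) * central_ratio l (Suc K))
        - qvar ^ (Suc K ^ 2 + Suc K) * ((1 - qvar ^ (l - Suc K)) * central_ratio l (Suc K))"
    by (metis (no_types) left_diff_distrib mult.assoc)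
  then show ?case
    using Suc central_ratio_Suc[of K l] by simp
qed simp

lemma weight_0: "weight 0 j k = (1 - qvar ^ (2 * k)) * qvar powi (int j * int k ^ 2 - int k) / (1 - qvar)"
  unfolding weight_def one_minus_qvar_double by (simp add: qint_def mult_ac)

text \<open>
  The factor \<open>[k]^2 q^(-k)\<close> by which the weight grows equals \<open>q^(-l) ([l]^2 - [l-k] [l+k])\<close>, and
  \<open>[l-k] [l+k]\<close> lowers the index of the central ratio from \<open>l\<close> to \<open>l - 1\<close>, at the cost of a factor \<open>[l]^2\<close>.  At
  \<open>k = l\<close> the product \<open>[l-k] [l+k]\<close> is zero, whereas \<open>central_ratio (l - 1) l\<close> is a junk value; hence the case
  distinction.
\<close>

lemma weight_Suc_central_ratio:
  assumes "1 \<le> k" "k \<le> l"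
  shows "weight (Suc m) j k * central_ratio l k = qvar powi (- int l) * qint l ^ 2 *
     (weight m j k * central_ratio l k - (if k < l then weight m j k * central_ratio (l - 1) k else 0))"
proof -
  have "weight (Suc m) j k = weight m j k * (qint k ^ 2 * qvar powi (- int k))"
  proof -
    have "int j * int k ^ 2 - (int (Suc m) + 1) * int k
        = (int j * int k ^ 2 - (int m + 1) * int k) + (- int k)"
      by (simp add: algebra_simps)
    then have "qvar powi (int j * int k ^ 2 - (int (Suc m) + 1) * int k)
        = qvar powi (int j * int k ^ 2 - (int m + 1) * int k) * qvar powi (- int k)"
      by (simp only: qvar_powi_add)
    moreover have "qint k ^ (2 * Suc m + 1) = qint k ^ (2 * m + 1) * qint k ^ 2"
      by (simp add: power2_eq_square)
    ultimately show ?thesis unfolding weight_def by (simp only: mult_ac)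
  qed
  moreover have "qint k ^ 2 * qvar powi (- int k) * central_ratio l k
      = qvar powi (- int l) * qint l ^ 2 *
          (central_ratio l k - (if k < l then central_ratio (l - 1) k else 0))"
  proof -
    obtain d where l: "l = k + d" using le_Suc_ex[OF assms(2)] by blast
    have "(1 - qvar ^ k) ^ 2 * qvar powi (- int k)
        = qvar powi (- int l) * ((1 - qvar ^ l) ^ 2 - (1 - qvar ^ (l - k)) * (1 - qvar ^ (l + k)))"
      unfolding l power_int_minus power_int_of_nat
      by (simp add: power_add field_simps power2_eq_square)
    then have "(1 - qvar ^ k) ^ 2 * qvar powi (- int k) * central_ratio l k
        = qvar powi (- int l) * ((1 - qvar ^ l) ^ 2 * central_ratio l k
            - (1 - qvar ^ (l - k)) * (1 - qvar ^ (l + k)) * central_ratio l k)"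
      by (simp add: left_diff_distrib)
    also have "(1 - qvar ^ (l - k)) * (1 - qvar ^ (l + k)) * central_ratio l k
        = (1 - qvar ^ l) ^ 2 * (if k < l then central_ratio (l - 1) k else 0)"
      using assms central_ratio_pred[of k l] by (cases "k < l") auto
    finally have "(1 - qvar ^ k) ^ 2 * qvar powi (- int k) * central_ratio l k
        = qvar powi (- int l) * (1 - qvar ^ l) ^ 2 *
          (central_ratio l k - (if k < l then central_ratio (l - 1) k else 0))"
      by (simp only: right_diff_distrib mult.assoc)
    then show ?thesis
      by (simp add: qint_def power_divide)
  qed
  ultimately have "weight (Suc m) j k * central_ratio l k
      = qvar powi (- int l) * qint l ^ 2 * (weight m j k *
          (central_ratio l k - (if k < l then central_ratio (l - 1) k else 0)))"
    by (metis (no_types) mult.assoc mult.left_commute)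
  then show ?thesis by (simp add: right_diff_distrib)
qed

lemma laurent_moment:
  assumes "j \<le> 1"
  shows "(\<Sum>k=1..l. weight m j k * central_ratio l k) \<in> int_laurent_polys"
proof (induction m arbitrary: l)
  case 0
  consider "j = 0" | "j = 1" using assms by linarith
  then show ?case
  proof cases
    case 1
    have "qvar ^ l * (\<Sum>k=1..l. weight 0 0 k * central_ratio l k) = qint l"
      using telescope_plain[of l l]
      by (simp add: weight_0 qint_def flip: sum_divide_distrib)
    then have "(\<Sum>k=1..l. weight 0 0 k * central_ratio l k) = qvar powi (- int l) * qint l"
      by (simp add: power_int_minus field_simps)
    then show ?thesis unfolding 1 by (simp only: laurent_intros)
  next
    case 2
    have "(\<Sum>k=1..l. weight 0 1 k * central_ratio l k) = qint l"
      using telescope_gaussian[of l l]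
      by (simp add: weight_0 qint_def flip: sum_divide_distrib)
    then show ?thesis unfolding 2 by (simp only: laurent_intros)
  qed
next
  case (Suc m)
  let ?R = "\<lambda>l. \<Sum>k=1..l. weight m j k * central_ratio l k"
  show ?case
  proof (cases "l = 0")
    case False
    have "(\<Sum>k=1..l. if k < l then weight m j k * central_ratio (l - 1) k else 0) = ?R (l - 1)"
      using False by (intro sum.mono_neutral_cong_right) auto
    then have "(\<Sum>k=1..l. weight (Suc m) j k * central_ratio l k)
        = qvar powi (- int l) * qint l ^ 2 * (?R l - ?R (l - 1))"
      by (simp add: weight_Suc_central_ratio sum_subtractf flip: sum_distrib_left)
    then show ?thesis by (simp only: laurent_intros Suc.IH)
  qed (simp add: laurent_intros)
qed

text \<open>
  Each linearization may lower the exponent \<open>j\<close> of \<open>q^(k^2)\<close> by one; this is done only when \<open>j\<close> is at its upper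
  bound.
\<close>

lemma linearization_weighted:
  assumes "k \<le> l" "l \<le> n" "j \<le> Suc s"
  shows "weight m j k * (qbinom n l * qbinom (2 * n) (n - k) * central_ratio l k)
      = qbinom (2 * n) (n - l) *
          (\<Sum>t=k..l. qvar ^ (if j \<le> s then (n - t) * (l - t) else t ^ 2)
            * (qbinom l t * qbinom n t * (weight m (min j s) k * central_ratio t k)))"
proof (cases "j \<le> s")
  case True
  then have "min j s = j" by simp
  then show ?thesis
    unfolding linearization[OF assms(1,2)] sum_distrib_left if_P[OF True]
    by (intro sum.cong refl) (simp only: mult_ac)
next
  case False
  then have j: "j = Suc s" "min j s = s" using assms(3) by auto
  have "int j * int k ^ 2 - (int m + 1) * int k
      = (int s * int k ^ 2 - (int m + 1) * int k) + int (k ^ 2)"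
    by (simp add: algebra_simps j)
  then have "qvar powi (int j * int k ^ 2 - (int m + 1) * int k)
      = qvar powi (int s * int k ^ 2 - (int m + 1) * int k) * qvar ^ (k ^ 2)"
    by (simp only: qvar_powi_add power_int_of_nat)
  then have w: "weight m j k = weight m s k * qvar ^ (k ^ 2)"
    unfolding weight_def by (simp only: mult_ac)
  show ?thesis
    unfolding w j(2) mult.assoc[of "weight m s k"] linearization_gaussian[OF assms(1,2)]
      sum_distrib_left if_not_P[OF False]
    by (intro sum.cong refl) (simp only: mult_ac)
qed

text \<open>
  The factor \<open>qbinom n l\<close> is what makes the induction on \<open>s\<close> work for all \<open>l \<le> n\<close>: it is consumed by the
  linearization, which hands a factor \<open>qbinom n t\<close> to each inner sum.  At \<open>l = n\<close> it is 1.
\<close>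

lemma laurent_power_moment:
  assumes "j \<le> s + 1" "l \<le> n"
  shows "qbinom n l * (\<Sum>k=1..l. weight m j k * qbinom (2 * n) (n - k) ^ s * central_ratio l k)
    \<in> int_laurent_polys"
  using assms
proof (induction s arbitrary: j l)
  case 0
  then show ?case
    using laurent_mult[OF laurent_qbinom laurent_moment[where j = j and l = l and m = m]] by simp
next
  case (Suc s)
  let ?b = "\<lambda>k. qbinom (2 * n) (n - k)"
  define j' where "j' = min j (s + 1)"
  define e where "e t = (if j \<le> s + 1 then (n - t) * (l - t) else t ^ 2)" for t
  have lin: "weight m j k * (qbinom n l * ?b k * central_ratio l k)
      = ?b l * (\<Sum>t=k..l. qvar ^ e t
          * (qbinom l t * qbinom n t * (weight m j' k * central_ratio t k)))" if "k \<le> l" for k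
    unfolding e_def j'_def using that Suc.prems by (intro linearization_weighted) auto
  have "qbinom n l * (\<Sum>k=1..l. weight m j k * ?b k ^ Suc s * central_ratio l k)
      = (\<Sum>k=1..l. ?b k ^ s * (weight m j k * (qbinom n l * ?b k * central_ratio l k)))"
    unfolding sum_distrib_left by (intro sum.cong refl) (simp only: power_Suc mult_ac)
  also have "\<dots> = (\<Sum>k=1..l. \<Sum>t=k..l. ?b l * (qvar ^ e t * (qbinom l t *
      (qbinom n t * (weight m j' k * ?b k ^ s * central_ratio t k)))))"
  proof (intro sum.cong refl)
    fix k assume "k \<in> {1..l}"
    then have "k \<le> l" by simp
    show "?b k ^ s * (weight m j k * (qbinom n l * ?b k * central_ratio l k))
      = (\<Sum>t=k..l. ?b l * (qvar ^ e t * (qbinom l t *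
          (qbinom n t * (weight m j' k * ?b k ^ s * central_ratio t k)))))"
      unfolding lin[OF \<open>k \<le> l\<close>] sum_distrib_left
      by (intro sum.cong refl) (simp only: mult_ac)
  qed
  also have "\<dots> = (\<Sum>t=1..l. \<Sum>k=1..t. ?b l * (qvar ^ e t * (qbinom l t *
      (qbinom n t * (weight m j' k * ?b k ^ s * central_ratio t k)))))"
    unfolding sum.Sigma[OF finite_atLeastAtMost ballI[OF finite_atLeastAtMost]]
    by (rule sum.reindex_bij_witness[of _ prod.swap prod.swap]) auto
  also have "\<dots> = ?b l * (\<Sum>t=1..l. qvar ^ e t * (qbinom l t *
      (qbinom n t * (\<Sum>k=1..t. weight m j' k * ?b k ^ s * central_ratio t k))))"
    by (simp add: sum_distrib_left)
  also have "\<dots> \<in> int_laurent_polys"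
    using Suc.prems by (intro laurent_intros Suc.IH) (auto simp: j'_def)
  finally show ?case .
qed

section \<open>Removing the remaining denominator\<close>

text \<open>
  Since \<open>q^n (1 - q^k) = (1 - q^(n+k)) - (1 - q^n)\<close> and
  \<open>(1 - q^(n+k)) qbinom (2n) (n-k) = (1 - q^(2n)) qbinom (2n-1) (n-k)\<close>, the numerator is divisible
  by \<open>1 - q^n\<close>.
\<close>

lemma laurent_qCatalan:
  assumes "1 \<le> k" "k \<le> n"
  shows "qCatalan n k \<in> int_laurent_polys"
proof -
  have n: "n \<ge> 1" using assms by simp
  let ?B = "qbinom (2 * n) (n - k)" and ?C = "qbinom (2 * n - 1) (n - k)"
  have nz: "1 - qvar ^ (n + k) \<noteq> 0" "1 - qvar ^ n \<noteq> 0"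
    using n qvar_power_neq_1[of "n + k"] qvar_power_neq_1[of n] by auto
  have B: "?B = qfact qvar (2 * n) / (qfact qvar (n - k) * qfact qvar (n + k))"
    using assms by (intro qbinom_eq) auto
  have C: "?C = qfact qvar (2 * n - 1) / (qfact qvar (n - k) * qfact qvar (n + k - 1))"
    using assms by (intro qbinom_eq) auto
  have "(1 - qvar ^ (n + k)) * ?B = (1 - qvar ^ (2 * n)) * ?C"
    unfolding B C using qfact_rec[of "2 * n"] qfact_rec[of "n + k"] n nz by simp
  then have *: "(1 - qvar ^ (n + k)) * ?B = (1 - qvar ^ n) * ((1 + qvar ^ n) * ?C)"
    by (simp only: one_minus_qvar_double mult.assoc)
  have "qvar ^ n * (1 - qvar ^ k) * ?B = (1 - qvar ^ (n + k)) * ?B - (1 - qvar ^ n) * ?B"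
    by (simp add: algebra_simps power_add)
  also have "\<dots> = (1 - qvar ^ n) * ((1 + qvar ^ n) * ?C - ?B)"
    unfolding * by (simp only: right_diff_distrib)
  finally have "qvar ^ n * (1 - qvar ^ k) * ?B / (1 - qvar ^ n) = (1 + qvar ^ n) * ?C - ?B"
    using nz by simp
  moreover have "qCatalan n k = qvar powi (- int n) * (qvar ^ n * (1 - qvar ^ k) * ?B / (1 - qvar ^ n))"
    by (simp add: qCatalan_def qint_def power_int_minus)
  ultimately have "qCatalan n k = qvar powi (- int n) * ((1 + qvar ^ n) * ?C - ?B)"
    by (simp only:)
  then show ?thesis by (simp only: laurent_intros)
qed

text \<open>
  A repeated factor would divide the derivative \<open>- m x^(m-1)\<close>, hence \<open>x^m\<close>, hence 1.
\<close>

lemma one_minus_monom_squarefree: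
  assumes "m > 0" "prime_elem (p :: rat poly)"
  shows "\<not> p ^ 2 dvd 1 - monom 1 m"
proof
  assume "p ^ 2 dvd 1 - monom 1 m"
  then obtain g where g: "1 - monom 1 m = p * (p * g)"
    by (metis dvdE mult.assoc power2_eq_square)
  have "p dvd pderiv (1 - monom 1 m)"
    unfolding g by (simp add: pderiv_mult)
  then have "p dvd monom (of_nat m) (m - 1)"
    by (simp add: pderiv_diff pderiv_monom)
  then have "p dvd monom (of_nat m) (m - 1) * monom (1 / of_nat m) 1"
    by (rule dvd_mult2)
  also have "monom (of_nat m) (m - 1) * monom (1 / of_nat m) 1 = monom (1 :: rat) m"
    using assms(1) by (simp add: mult_monom)
  finally have "p dvd monom 1 m" .
  moreover have "p dvd 1 - monom 1 m" unfolding g by simp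
  ultimately have "p dvd 1" by (metis diff_add_cancel dvd_add)
  then show False using assms(2) by (simp add: prime_elem_def)
qed

lemma multiplicity_one_minus_monom:
  assumes "m > 0" "prime_elem (p :: rat poly)"
  shows "multiplicity p (1 - monom 1 m) = (if p dvd 1 - monom 1 m then 1 else 0)"
  using one_minus_monom_squarefree[OF assms]
  by (auto intro!: multiplicity_eqI not_dvd_imp_multiplicity_0 simp: numeral_2_eq_2)

lemma one_minus_monom_nonzero: "m > 0 \<Longrightarrow> 1 - monom 1 m \<noteq> (0 :: rat poly)"
  by (metis degree_1 degree_monom_eq eq_iff_diff_eq_0 less_irrefl one_neq_zero)

lemma qfact_eq_to_fract: "qfact qvar n = to_fract (\<Prod>i<n. 1 - monom 1 (Suc i))"
  by (induction n) (simp_all add: qfact_Suc qvar_power del: power_Suc)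

text \<open>
  The central coefficient is the product of the \<open>1 - x^(n+i)\<close> divided by the product of the
  \<open>1 - x^i\<close>, for \<open>1 \<le> i \<le> n\<close>.  A prime factor \<open>p\<close> of \<open>1 - x^n\<close> has the same multiplicity in
  \<open>1 - x^(n+i)\<close> as in \<open>1 - x^i\<close>, because the two differ by \<open>x^i (1 - x^n)\<close>, so
  that \<open>p\<close> divides both or neither, and no multiplicity exceeds 1.
\<close>

lemma coprime_central_qbinom:
  assumes "n > 0" "qbinom (2 * n) n = to_fract b"
  shows "coprime b (1 - monom 1 n)"
proof (rule ccontr)
  define f :: "nat \<Rightarrow> rat poly" where "f m = 1 - monom 1 m" for m
  assume "\<not> coprime b (1 - monom 1 n)"
  then have "\<not> is_unit (gcd b (f n))" "gcd b (f n) \<noteq> 0"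
    using one_minus_monom_nonzero[OF assms(1)] by (auto simp: f_def)
  then obtain p where "p dvd gcd b (f n)" "prime p"
    using prime_divisor_exists by blast
  then have p: "prime_elem p" "p dvd b" "p dvd f n"
    by auto
  have "qfact qvar (n + n) = qfact qvar n * to_fract (\<Prod>i<n. f (n + Suc i))"
  proof -
    have "(\<Prod>i<n + k. f (Suc i)) = (\<Prod>i<n. f (Suc i)) * (\<Prod>i<k. f (n + Suc i))" for k
      by (induction k) (simp_all add: mult.assoc)
    then show ?thesis
      unfolding qfact_eq_to_fract f_def[symmetric] to_fract_mult[symmetric] by (simp only:)
  qed
  then have "to_fract b * qfact qvar n = to_fract (\<Prod>i<n. f (n + Suc i))"
    using assms(2) qbinom_eq[of n n "2 * n"] by (simp add: mult_2)
  then have eq: "b * (\<Prod>i<n. f (Suc i)) = (\<Prod>i<n. f (n + Suc i))"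
    unfolding qfact_eq_to_fract f_def[symmetric] to_fract_mult[symmetric] to_fract_eq_iff .
  have nz: "f m \<noteq> 0" if "m > 0" for m
    using one_minus_monom_nonzero[OF that] by (simp add: f_def)
  have "p dvd f (n + m) \<longleftrightarrow> p dvd f m" for m
  proof -
    have "f (n + m) = f m + monom 1 m * f n"
      by (simp add: f_def algebra_simps mult_monom)
    then show ?thesis using p(3) by (simp add: dvd_add_left_iff)
  qed
  then have mult: "multiplicity p (f (n + Suc i)) = multiplicity p (f (Suc i))" for i
    using multiplicity_one_minus_monom[OF _ p(1)] by (simp add: f_def del: add_Suc_right)
  have b: "b \<noteq> 0" using assms(2) by (auto simp: qbinom_eq[of n n "2 * n"])
  have "multiplicity p b + multiplicity p (\<Prod>i<n. f (Suc i)) = multiplicity p (\<Prod>i<n. f (n + Suc i))"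
    unfolding eq[symmetric] using p(1) b nz
    by (intro prime_elem_multiplicity_mult_distrib[symmetric]) auto
  also have "\<dots> = multiplicity p (\<Prod>i<n. f (Suc i))"
    using p(1) nz by (subst (1 2) prime_elem_multiplicity_prod_distrib) (auto simp: mult simp del: add_Suc_right)
  finally have "multiplicity p b = 0" by simp
  then show False using p(1,2) b
    by (simp add: multiplicity_eq_zero_iff prime_elem_def)
qed

text \<open>
  The constant coefficient of \<open>1 - x^n\<close> is a unit of the integers, so the coefficients of the quotient can be
  computed from the lowest one upwards without division.
\<close>

lemma int_coeffs_cancel:
  assumes "n > 0" "(1 - monom 1 n) * y \<in> int_coeffs"
  shows "y \<in> int_coeffs"
proof -
  have "coeff y i \<in> \<int>" for i
  proof (induction i rule: less_induct)
    case (less i)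
    have "coeff y i = coeff ((1 - monom 1 n) * y) i + (if n \<le> i then coeff y (i - n) else 0)"
      by (simp add: left_diff_distrib coeff_monom_mult)
    moreover have "coeff ((1 - monom 1 n) * y) i \<in> \<int>"
      using assms(2) by (simp add: int_coeffs_def)
    moreover have "(if n \<le> i then coeff y (i - n) else 0) \<in> \<int>"
      using assms(1) less by auto
    ultimately show ?case by (metis Ints_add)
  qed
  then show ?thesis by (simp add: int_coeffs_def)
qed

text \<open>
  A Bezout identity over the rationals shows that \<open>x\<close> is a Laurent polynomial with rational coefficients; that
  these are integral follows by cancelling the factors \<open>1 - q^n\<close> one at a time.
\<close>

lemma laurent_of_coprime_multiples:
  assumes "n > 0"
    and b: "qbinom (2 * n) n * x \<in> int_laurent_polys"
    and s: "(1 - qvar ^ n) ^ s * x \<in> int_laurent_polys"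
  shows "x \<in> int_laurent_polys"
proof -
  let ?f = "1 - monom 1 n :: rat poly"
  obtain \<beta> where \<beta>: "qbinom (2 * n) n = to_fract \<beta>"
    using qbinom_polynomial by blast
  obtain N p p' where p: "p' \<in> int_coeffs"
    "qbinom (2 * n) n * x * qvar ^ N = to_fract p" "(1 - qvar ^ n) ^ s * x * qvar ^ N = to_fract p'"
    using int_laurent_polys_common_denominator[OF b s] by metis
  have f: "(1 - qvar ^ n) ^ s = to_fract (?f ^ s)"
    by (induction s) (simp_all add: qvar_power)
  have "coprime \<beta> (?f ^ s)"
    using coprime_central_qbinom[OF assms(1) \<beta>] by simp
  then obtain u v where uv: "u * \<beta> + v * ?f ^ s = 1"
    by (metis bezout_coefficients_fst_snd coprime_iff_gcd_eq_1)
  have "x * qvar ^ N = to_fract (u * \<beta> + v * ?f ^ s) * (x * qvar ^ N)"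
    by (simp add: uv)
  also have "\<dots> = to_fract u * (qbinom (2 * n) n * x * qvar ^ N)
      + to_fract v * ((1 - qvar ^ n) ^ s * x * qvar ^ N)"
    unfolding \<beta> f by (simp add: algebra_simps)
  also have "\<dots> = to_fract (u * p + v * p')"
    unfolding p by simp
  finally have x: "x * qvar ^ N = to_fract (u * p + v * p')" .
  have "to_fract (?f ^ s * (u * p + v * p')) = to_fract p'"
    using p(3) unfolding f by (simp only: to_fract_mult x[symmetric] mult.assoc)
  then have "?f ^ s * (u * p + v * p') \<in> int_coeffs"
    using p(1) by (simp only: to_fract_eq_iff)
  then have "u * p + v * p' \<in> int_coeffs"
    by (induction s) (use int_coeffs_cancel[OF assms(1)] in \<open>auto simp: mult.assoc\<close>)
  then show ?thesis using x unfolding int_laurent_polys_iff by blast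
qed

text \<open>
  One factor \<open>qbinom (2n) (n-k)\<close> absorbs the inverse central coefficient and becomes \<open>central_ratio n k\<close>, while
  \<open>s\<close> further factors \<open>[k]\<close> come from the entries of the triangle; they raise the exponent of
  \<open>[k]\<close> from \<open>r\<close> to the odd number \<open>r + s = 2 m + 1\<close>.
\<close>

theorem theorem1p3:
  fixes n r s j :: nat
  assumes "n \<ge> 1" and "s \<ge> 1" and "r mod 2 \<noteq> s mod 2" and "j \<le> s"
  shows "inverse (qbinom (2 * n) n) *
      (\<Sum>k=1..n. (1 + qvar ^ k) * qint k ^ r * qCatalan n k ^ s *
         qvar powi (int j * int k ^ 2 - ((int r + int s + 1) * int k) div 2))
    \<in> int_laurent_polys"
proof (rule laurent_of_coprime_multiples)
  let ?S = "\<Sum>k=1..n. (1 + qvar ^ k) * qint k ^ r * qCatalan n k ^ s *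
         qvar powi (int j * int k ^ 2 - ((int r + int s + 1) * int k) div 2)"
  show n: "n > 0" using assms(1) by simp
  have b: "qbinom (2 * n) n \<noteq> 0" by (simp add: qbinom_eq[of n n "2 * n"])
  have "?S \<in> int_laurent_polys"
    by (intro laurent_intros laurent_qCatalan) auto
  then show "qbinom (2 * n) n * (inverse (qbinom (2 * n) n) * ?S) \<in> int_laurent_polys"
    using b by (simp flip: mult.assoc)
  have "odd (r + s)"
    using assms(3) by (metis even_add odd_iff_mod_2_eq_one even_iff_mod_2_eq_zero)
  then obtain m where m: "r + s = 2 * m + 1" by (rule oddE)
  obtain s' where s': "s = Suc s'" using assms(2) by (cases s) auto
  have nz: "1 - qvar ^ n \<noteq> 0" using n qvar_power_neq_1[of n] by simp
  have "(1 - qvar ^ n) ^ s * (inverse (qbinom (2 * n) n) *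
      ((1 + qvar ^ k) * qint k ^ r * qCatalan n k ^ s *
         qvar powi (int j * int k ^ 2 - ((int r + int s + 1) * int k) div 2)))
     = (1 - qvar) ^ s * (weight m j k * qbinom (2 * n) (n - k) ^ s' * central_ratio n k)"
    if "k \<in> {1..n}" for k
  proof -
    have "int r + int s + 1 = 2 * (int m + 1)"
      using arg_cong[OF m, of int] by simp
    then have e: "((int r + int s + 1) * int k) div 2 = (int m + 1) * int k"
      by (metis mult.assoc nonzero_mult_div_cancel_left zero_neq_numeral)
    have c: "central_ratio n k = inverse (qbinom (2 * n) n) * qbinom (2 * n) (n - k)"
      using that by (simp add: qbinom_eq[of n n "2 * n"] qbinom_eq[of "n - k" "n + k" "2 * n"]
        central_ratio_def power2_eq_square)
    have B: "(1 - qvar ^ n) ^ s * qCatalan n k ^ s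
        = (1 - qvar) ^ s * (qint k ^ s * (qbinom (2 * n) (n - k) * qbinom (2 * n) (n - k) ^ s'))"
      unfolding power_Suc[symmetric] s'[symmetric] power_mult_distrib[symmetric] using nz
      by (simp add: qCatalan_def qint_def)
    have M: "qint k ^ (2 * m + 1) = qint k ^ r * qint k ^ s"
      by (simp only: power_add flip: m)
    have "(1 - qvar ^ n) ^ s * (inverse (qbinom (2 * n) n) * ((1 + qvar ^ k) * qint k ^ r *
          qCatalan n k ^ s * qvar powi (int j * int k ^ 2 - (int m + 1) * int k)))
        = ((1 - qvar ^ n) ^ s * qCatalan n k ^ s) * (inverse (qbinom (2 * n) n) * ((1 + qvar ^ k)
          * qint k ^ r * qvar powi (int j * int k ^ 2 - (int m + 1) * int k)))"
      by (simp only: mult_ac)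
    then show ?thesis
      unfolding e weight_def B M c by (simp only: mult_ac)
  qed
  then have "(1 - qvar ^ n) ^ s * (inverse (qbinom (2 * n) n) * ?S)
      = (1 - qvar) ^ s * (qbinom n n *
          (\<Sum>k=1..n. weight m j k * qbinom (2 * n) (n - k) ^ s' * central_ratio n k))"
    by (simp add: sum_distrib_left qbinom_eq[of n 0 n])
  moreover have "qbinom n n * (\<Sum>k=1..n. weight m j k * qbinom (2 * n) (n - k) ^ s'
      * central_ratio n k) \<in> int_laurent_polys"
    using assms(4) s' by (intro laurent_power_moment) auto
  moreover have "1 - qvar \<in> int_laurent_polys"
    using laurent_qvar_power[of 1] by (auto intro!: laurent_intros)
  ultimately show "(1 - qvar ^ n) ^ s * (inverse (qbinom (2 * n) n) * ?S) \<in> int_laurent_polys"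
    by (auto intro!: laurent_mult laurent_power)
qed

end
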